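(* Let $d\ge1$, $\mathbf n\in\mathbb N^d$, and let $\{Y_{\mathbf k};\ \mathbf k\le\mathbf n\}$ be a negatively associated field of random variables with $\mathbb E Y_{\mathbf k}=0$ and $|Y_{\mathbf k}|\le b$ a.s. for some $0<b<\infty$. Let $T_{\mathbf k}=\sum_{\mathbf i\le\mathbf k}Y_{\mathbf i}$, $M_{\mathbf n}=\max_{\mathbf k\le\mathbf n}|T_{\mathbf k}|$ and $B_{\mathbf n}^2=\sum_{\mathbf k\le\mathbf n}\mathbb E Y_{\mathbf k}^2$. Then for all $x>0$, $$\mathbb P\big(M_{\mathbf n}-2\mathbb E M_{\mathbf n}\ge 20x\big)\le 2^{d+1}\exp\Big(-\frac{x^2}{2(bx+B_{\mathbf n}^2)}\Big).$$
   Context: A finite family of random variables $\{Y_i; i\in I\}$ is negatively associated if for every pair of disjoint subsets $A,B\subset I$, $\operatorname{Cov}(f(Y_i;i\in A),g(Y_j;j\in B))\le 0$ whenever $f,g$ are coordinatewise non-decreasing and the covariance exists. Indices are in $\mathbb N^d$ (positive integer coordinates), and $\mathbf k\le\mathbf n$ means $k_i\le n_i$ for all $i=1,\dots,d$. *)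

theory Defs
  imports "HOL-Probability.Probability"
begin

text \<open>Multi-indices in N^d (positive coordinates) are functions nat \<Rightarrow> nat,
  extensional on {..<d}. The set of indices k with 1 \<le> k \<le> n componentwise:\<close>
definition idx :: "nat \<Rightarrow> (nat \<Rightarrow> nat) \<Rightarrow> (nat \<Rightarrow> nat) set" where
  "idx d n = (\<Pi>\<^sub>E i\<in>{..<d}. {1..n i})"

definition coord_mono :: "'i set \<Rightarrow> (('i \<Rightarrow> real) \<Rightarrow> real) \<Rightarrow> bool" where
  "coord_mono A f \<longleftrightarrow>
     (\<forall>x\<in>extensional A. \<forall>y\<in>extensional A. (\<forall>i\<in>A. x i \<le> y i) \<longrightarrow> f x \<le> f y)"

definition neg_assoc :: "'a measure \<Rightarrow> ('i \<Rightarrow> 'a \<Rightarrow> real) \<Rightarrow> 'i set \<Rightarrow> bool" where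
  "neg_assoc P Y I \<longleftrightarrow>
     (\<forall>A B f g. A \<subseteq> I \<and> B \<subseteq> I \<and> A \<inter> B = {} \<and> coord_mono A f \<and> coord_mono B g \<and>
        integrable P (\<lambda>\<omega>. f (restrict (\<lambda>i. Y i \<omega>) A)) \<and>
        integrable P (\<lambda>\<omega>. g (restrict (\<lambda>i. Y i \<omega>) B)) \<and>
        integrable P (\<lambda>\<omega>. f (restrict (\<lambda>i. Y i \<omega>) A) * g (restrict (\<lambda>i. Y i \<omega>) B))
      \<longrightarrow> (\<integral>\<omega>. f (restrict (\<lambda>i. Y i \<omega>) A) * g (restrict (\<lambda>i. Y i \<omega>) B) \<partial>P)
          - (\<integral>\<omega>. f (restrict (\<lambda>i. Y i \<omega>) A) \<partial>P) * (\<integral>\<omega>. g (restrict (\<lambda>i. Y i \<omega>) B) \<partial>P) \<le> 0)"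

definition partial_sum :: "nat \<Rightarrow> ((nat \<Rightarrow> nat) \<Rightarrow> 'a \<Rightarrow> real) \<Rightarrow> (nat \<Rightarrow> nat) \<Rightarrow> 'a \<Rightarrow> real" where
  "partial_sum d Y k \<omega> = (\<Sum>i\<in>idx d k. Y i \<omega>)"

definition max_partial :: "nat \<Rightarrow> ((nat \<Rightarrow> nat) \<Rightarrow> 'a \<Rightarrow> real) \<Rightarrow> (nat \<Rightarrow> nat) \<Rightarrow> 'a \<Rightarrow> real" where
  "max_partial d Y n \<omega> = Max ((\<lambda>k. \<bar>partial_sum d Y k \<omega>\<bar>) ` idx d n)"

end

theory Submission
  imports Defs
begin

text \<open>
  No comparison with independent variables is available for maxima over rectangles, so the
  index set is split at random instead. For \<open>A \<subseteq> I\<close> let \<open>F A\<close> be the maximum over the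
  rectangles \<open>D\<close> of the sum over \<open>A \<inter> D\<close>, and \<open>G A\<close> the maximum of the sums over \<open>D\<close> in which
  the terms outside \<open>A\<close> change sign. Negative association of \<open>F A\<close> and \<open>F (I - A)\<close>, both
  monotone, together with \<open>F A - F (I - A) \<le> G A\<close> bounds the exponential moment of
  \<open>F A - E (F (I - A))\<close> by that of \<open>G A\<close>. Averaging over all \<open>A\<close> and using
  \<open>F I \<le> F A + F (I - A)\<close>, \<open>2 F A \<le> F I + G A\<close> and Jensen's inequality turns this into a bound
  for \<open>F I - E (F I)\<close>. For uniformly distributed \<open>A\<close> and fixed values of the field, \<open>G A\<close> is
  governed by a Rademacher sum, so Levy's inequality in each of the \<open>d\<close> directions costs a factor
  \<open>2 ^ d\<close>, and the sum over all of \<open>I\<close> has exponential moments controlled by negative association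
  within \<open>A\<close> and within \<open>I - A\<close>. The excess constants are absorbed because the claim is trivial
  unless \<open>2 ^ d\<close> is dominated by the exponential.
\<close>

section \<open>Reflection of random signs\<close>

text \<open>A subset \<open>A\<close> encodes a vector of signs. Counting on \<open>Pow I\<close>
  thereby replaces the law of independent Rademacher signs, and probabilities become
  cardinalities.\<close>

definition signed_sum :: "('i \<Rightarrow> real) \<Rightarrow> 'i set \<Rightarrow> 'i set \<Rightarrow> real" where
  "signed_sum y A D = (\<Sum>i\<in>D. if i \<in> A then y i else - y i)"

text \<open>Levy's reflection principle in one direction, uniformly over the family
  \<open>\<D>\<close>. Flipping the signs beyond the first successful level leaves that level
  unchanged, so the flip is undone by itself and is injective. The part of \<open>D\<close> beyond
  the level has opposite values for \<open>A\<close> and its reflection, hence for one of the two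
  the sum over all of \<open>D\<close> is still at least \<open>u\<close>.\<close>

lemma card_signed_sum_reflection:
  fixes y :: "'i \<Rightarrow> real" and \<tau> :: "'i \<Rightarrow> nat"
  assumes fin: "finite I" and sub: "\<And>D. D \<in> \<D> \<Longrightarrow> D \<subseteq> I"
  shows "card {A\<in>Pow I. \<exists>D\<in>\<D>. \<exists>j. u \<le> signed_sum y A {i\<in>D. \<tau> i \<le> j}}
         \<le> 2 * card {A\<in>Pow I. \<exists>D\<in>\<D>. u \<le> signed_sum y A D}" (is "card ?E \<le> 2 * card ?R")
proof -
  define hit where "hit A j \<longleftrightarrow> (\<exists>D\<in>\<D>. u \<le> signed_sum y A {i\<in>D. \<tau> i \<le> j})" for A j
  define m where "m A = (LEAST j. hit A j)" for A
  \<comment> \<open>flip all signs after the first time the level \<open>u\<close> is reached\<close>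
  define \<phi> where "\<phi> A = {i\<in>I. (i \<in> A) = (\<tau> i \<le> m A)}" for A
  have hit_m: "hit A (m A)" if "A \<in> ?E" for A
  proof -
    from that obtain j where "hit A j" by (auto simp: hit_def)
    then show ?thesis unfolding m_def by (rule LeastI)
  qed
  have same: "signed_sum y (\<phi> A) {i\<in>D. \<tau> i \<le> j} = signed_sum y A {i\<in>D. \<tau> i \<le> j}"
    if "j \<le> m A" "D \<in> \<D>" for A j D
    unfolding signed_sum_def using that sub[OF that(2)] by (intro sum.cong) (auto simp: \<phi>_def)
  have hit_same: "hit (\<phi> A) j = hit A j" if "j \<le> m A" for A j
    using same[OF that] by (auto simp: hit_def)
  have m_same: "m (\<phi> A) = m A" if "A \<in> ?E" for A
    unfolding m_def[of "\<phi> A"]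
  proof (rule Least_equality)
    show "hit (\<phi> A) (m A)" using hit_m[OF that] hit_same by simp
    show "m A \<le> j" if "hit (\<phi> A) j" for j
    proof (rule ccontr)
      assume "\<not> m A \<le> j"
      with that hit_same have "hit A j" by simp
      then have "m A \<le> j" unfolding m_def by (rule Least_le)
      with \<open>\<not> m A \<le> j\<close> show False by simp
    qed
  qed
  have invol: "\<phi> (\<phi> A) = A" if "A \<in> ?E" for A
    using that m_same[OF that] by (auto simp: \<phi>_def)
  have inj: "inj_on \<phi> ?E"
    by (rule inj_on_inverseI[of _ \<phi>]) (rule invol)
  have cover: "A \<in> ?R \<or> \<phi> A \<in> ?R" if A: "A \<in> ?E" for A
  proof -
    from hit_m[OF A] obtain D where D: "D \<in> \<D>" "u \<le> signed_sum y A {i\<in>D. \<tau> i \<le> m A}"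
      by (auto simp: hit_def)
    have finD: "finite D" using fin sub[OF D(1)] by (rule rev_finite_subset)
    have split: "signed_sum y A' D
        = signed_sum y A' {i\<in>D. \<tau> i \<le> m A} + signed_sum y A' {i\<in>D. \<not> \<tau> i \<le> m A}" for A'
      unfolding signed_sum_def using finD
      by (subst sum.union_disjoint[symmetric]) (auto intro!: sum.cong)
    have "signed_sum y (\<phi> A) {i\<in>D. \<not> \<tau> i \<le> m A} = - signed_sum y A {i\<in>D. \<not> \<tau> i \<le> m A}"
      unfolding signed_sum_def sum_negf[symmetric] using sub[OF D(1)]
      by (intro sum.cong) (auto simp: \<phi>_def)
    then have "u \<le> signed_sum y A D \<or> u \<le> signed_sum y (\<phi> A) D"
      using D(2) same[OF order_refl D(1), of A] split[of A] split[of "\<phi> A"] by linarith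
    moreover have "\<phi> A \<subseteq> I" by (auto simp: \<phi>_def)
    ultimately show ?thesis using D(1) A by auto
  qed
  have finR: "finite ?R" and finE: "finite ?E" using fin by auto
  have "card ?E \<le> card (?R \<union> {A\<in>?E. \<phi> A \<in> ?R})"
  proof (rule card_mono)
    show "finite (?R \<union> {A\<in>?E. \<phi> A \<in> ?R})"
      by (intro finite_UnI finR finite_subset[OF Collect_restrict finE])
    show "?E \<subseteq> ?R \<union> {A\<in>?E. \<phi> A \<in> ?R}"
    proof
      fix A assume "A \<in> ?E"
      with cover[OF this] show "A \<in> ?R \<union> {A\<in>?E. \<phi> A \<in> ?R}" by (elim disjE) simp_all
    qed
  qed
  also have "\<dots> \<le> card ?R + card {A\<in>?E. \<phi> A \<in> ?R}" by (rule card_Un_le)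
  also have "card {A\<in>?E. \<phi> A \<in> ?R} \<le> card ?R"
  proof (rule card_inj_on_le[of \<phi>])
    show "inj_on \<phi> {A\<in>?E. \<phi> A \<in> ?R}" 
      by (rule inj_on_subset[OF inj Collect_restrict])
    show "\<phi> ` {A\<in>?E. \<phi> A \<in> ?R} \<subseteq> ?R" by (rule image_subsetI) simp
  qed (rule finR)
  finally show ?thesis by simp
qed

text \<open>Truncations are removed one direction at a time: reflection along the last direction is
  applied to the family of sets already truncated in the earlier ones, and each removal doubles the
  count.\<close>

lemma card_signed_sum_levy:
  fixes y :: "'i \<Rightarrow> real" and \<tau> :: "nat \<Rightarrow> 'i \<Rightarrow> nat"
  assumes fin: "finite I"
  shows "card {A\<in>Pow I. \<exists>k. u \<le> signed_sum y A {i\<in>I. \<forall>c<d. \<tau> c i \<le> k c}}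
         \<le> 2 ^ d * card {A\<in>Pow I. u \<le> signed_sum y A I}"
proof (induction d)
  case 0
  then show ?case by simp
next
  case (Suc d)
  let ?\<D> = "range (\<lambda>k. {i\<in>I. \<forall>c<d. \<tau> c i \<le> k c})"
  have step: "{i\<in>I. \<forall>c<Suc d. \<tau> c i \<le> k c} = {i\<in>{i\<in>I. \<forall>c<d. \<tau> c i \<le> k c}. \<tau> d i \<le> k d}" for k
    by (auto simp: less_Suc_eq)
  have "{A\<in>Pow I. \<exists>k. u \<le> signed_sum y A {i\<in>I. \<forall>c<Suc d. \<tau> c i \<le> k c}}
      \<subseteq> {A\<in>Pow I. \<exists>D\<in>?\<D>. \<exists>j. u \<le> signed_sum y A {i\<in>D. \<tau> d i \<le> j}}"
  proof (intro subsetI)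
    fix A assume "A \<in> {A\<in>Pow I. \<exists>k. u \<le> signed_sum y A {i\<in>I. \<forall>c<Suc d. \<tau> c i \<le> k c}}"
    then obtain k where "A \<in> Pow I" "u \<le> signed_sum y A {i\<in>I. \<forall>c<Suc d. \<tau> c i \<le> k c}"
      by blast
    with step[of k] have "\<exists>j. u \<le> signed_sum y A {i\<in>{i\<in>I. \<forall>c<d. \<tau> c i \<le> k c}. \<tau> d i \<le> j}"
      by (intro exI[of _ "k d"]) simp
    with \<open>A \<in> Pow I\<close> show "A \<in> {A\<in>Pow I. \<exists>D\<in>?\<D>. \<exists>j. u \<le> signed_sum y A {i\<in>D. \<tau> d i \<le> j}}"
      by blast
  qed
  then have "card {A\<in>Pow I. \<exists>k. u \<le> signed_sum y A {i\<in>I. \<forall>c<Suc d. \<tau> c i \<le> k c}}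
      \<le> card {A\<in>Pow I. \<exists>D\<in>?\<D>. \<exists>j. u \<le> signed_sum y A {i\<in>D. \<tau> d i \<le> j}}"
    using fin by (intro card_mono) auto
  also have "\<dots> \<le> 2 * card {A\<in>Pow I. \<exists>D\<in>?\<D>. u \<le> signed_sum y A D}"
    by (rule card_signed_sum_reflection[OF fin]) auto
  also have "\<dots> = 2 * card {A\<in>Pow I. \<exists>k. u \<le> signed_sum y A {i\<in>I. \<forall>c<d. \<tau> c i \<le> k c}}"
    by simp
  finally show ?case using Suc.IH by simp
qed

text \<open>Layer-cake formula for counting measure on \<open>S\<close>: a nonnegative sum is the
  integral over positive levels of the superlevel counts, so the comparison of counts integrates.
  This carries Levy's inequality from tails to exponential moments.\<close>

lemma sum_le_of_card_superlevel_le: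
  fixes X Z :: "'a \<Rightarrow> real"
  assumes fin: "finite S" and X: "\<And>a. a \<in> S \<Longrightarrow> 0 \<le> X a" and Z: "\<And>a. a \<in> S \<Longrightarrow> 0 \<le> Z a"
    and le: "\<And>u. 0 < u \<Longrightarrow> card {a\<in>S. u \<le> X a} \<le> C * card {a\<in>S. u \<le> Z a}"
  shows "sum X S \<le> real C * sum Z S"
proof -
  have layer: "ennreal (sum V S) = (\<integral>\<^sup>+u. (\<Sum>a\<in>S. indicator {0<..V a} u) \<partial>lborel)"
    if V: "\<And>a. a \<in> S \<Longrightarrow> 0 \<le> V a" for V :: "'a \<Rightarrow> real"
  proof -
    have "ennreal (sum V S) = (\<Sum>a\<in>S. emeasure lborel {0<..V a})"
      using V by simp
    also have "\<dots> = (\<Sum>a\<in>S. \<integral>\<^sup>+u. indicator {0<..V a} u \<partial>lborel)" by simp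
    also have "\<dots> = (\<integral>\<^sup>+u. (\<Sum>a\<in>S. indicator {0<..V a} u) \<partial>lborel)"
      by (rule nn_integral_sum[symmetric]) simp
    finally show ?thesis .
  qed
  have count: "(\<Sum>a\<in>S. indicator {0<..V a} u :: ennreal)
      = of_nat (card {a\<in>S. u \<le> V a}) * indicator {0<..} u" for V :: "'a \<Rightarrow> real" and u
  proof -
    have "(\<Sum>a\<in>S. indicator {0<..V a} u :: ennreal)
        = (\<Sum>a\<in>S. if u \<le> V a then indicator {0<..} u else 0)"
      by (intro sum.cong) (auto simp: indicator_def)
    also have "\<dots> = of_nat (card {a\<in>S. u \<le> V a}) * indicator {0<..} u"
      using fin by (simp add: sum.If_cases Int_def)
    finally show ?thesis .
  qed
  have "(\<Sum>a\<in>S. indicator {0<..X a} u :: ennreal) \<le> of_nat C * (\<Sum>a\<in>S. indicator {0<..Z a} u)" for u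
  proof (cases "0 < u")
    case True
    have "of_nat (card {a\<in>S. u \<le> X a}) \<le> (of_nat (C * card {a\<in>S. u \<le> Z a}) :: ennreal)"
      using le[OF True] by (rule of_nat_mono)
    then show ?thesis using True by (simp add: count)
  qed (simp add: count)
  then have "(\<integral>\<^sup>+u. (\<Sum>a\<in>S. indicator {0<..X a} u) \<partial>lborel)
      \<le> (\<integral>\<^sup>+u. of_nat C * (\<Sum>a\<in>S. indicator {0<..Z a} u) \<partial>lborel)"
    by (intro nn_integral_mono)
  then have "ennreal (sum X S) \<le> (\<integral>\<^sup>+u. of_nat C * (\<Sum>a\<in>S. indicator {0<..Z a} u) \<partial>lborel)"
    using layer[of X] X by simp
  also have "\<dots> = of_nat C * (\<integral>\<^sup>+u. (\<Sum>a\<in>S. indicator {0<..Z a} u) \<partial>lborel)"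
    by (rule nn_integral_cmult) simp
  also have "\<dots> = of_nat C * ennreal (sum Z S)"
    using layer[of Z] Z by simp
  also have "\<dots> = ennreal (real C * sum Z S)"
    by (simp add: ennreal_mult' ennreal_of_nat_eq_real_of_nat)
  finally show ?thesis using Z by (simp add: sum_nonneg)
qed


section \<open>Maximal sums over random subsets\<close>

definition max_sum :: "('i \<Rightarrow> real) \<Rightarrow> 'i set set \<Rightarrow> 'i set \<Rightarrow> real" where
  "max_sum y \<K> A = Max ((\<lambda>D. sum y (A \<inter> D)) ` \<K>)"

definition max_signed :: "('i \<Rightarrow> real) \<Rightarrow> 'i set set \<Rightarrow> 'i set \<Rightarrow> real" where
  "max_signed y \<K> A = Max (signed_sum y A ` \<K>)"

lemma signed_sum_eq:
  assumes "finite D"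
  shows "signed_sum y A D = sum y (A \<inter> D) - sum y (D - A)"
proof -
  have "signed_sum y A D = sum y (D \<inter> A) + (\<Sum>i\<in>D - A. - y i)"
    unfolding signed_sum_def using assms by (simp add: sum.If_cases Diff_eq)
  then show ?thesis by (simp add: sum_negf Int_commute)
qed

lemma card_Pow_real:
  assumes "finite I"
  shows "real (card (Pow I)) = 2 ^ card I"
  using assms by (simp add: card_Pow)

lemma sum_Pow_compl: "(\<Sum>A\<in>Pow I. h (I - A)) = (\<Sum>A\<in>Pow I. h A)"
  by (rule sum.reindex_bij_witness[of _ "\<lambda>A. I - A" "\<lambda>A. I - A"]) auto

text \<open>Jensen's inequality for a uniform average, from the tangent line of the exponential at
  the mean.\<close>

lemma exp_mean_le:
  fixes z :: "'a \<Rightarrow> real"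
  assumes "finite S" "S \<noteq> {}"
  shows "real (card S) * exp (sum z S / real (card S)) \<le> (\<Sum>a\<in>S. exp (z a))"
proof -
  define m where "m = sum z S / real (card S)"
  have c: "real (card S) > 0" using assms by (simp add: card_gt_0_iff)
  have "real (card S) * exp m = exp m * (\<Sum>a\<in>S. 1 + (z a - m))"
    using c by (simp add: sum.distrib sum_subtractf m_def)
  also have "\<dots> \<le> exp m * (\<Sum>a\<in>S. exp (z a - m))"
    by (intro mult_left_mono sum_mono exp_ge_add_one_self) simp
  also have "\<dots> = (\<Sum>a\<in>S. exp (z a))"
    by (simp add: sum_distrib_left exp_add[symmetric])
  finally show ?thesis by (simp add: m_def)
qed

locale finite_set_family =
  fixes I :: "'i set" and \<K> :: "'i set set"
  assumes finI: "finite I" and finK: "finite \<K>" and neK: "\<K> \<noteq> {}"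
    and subK: "\<And>D. D \<in> \<K> \<Longrightarrow> D \<subseteq> I"
begin

lemma sum_le_max_sum: "D \<in> \<K> \<Longrightarrow> sum y (A \<inter> D) \<le> max_sum y \<K> A"
  unfolding max_sum_def using finK by (intro Max_ge) auto

lemma signed_le_max_signed: "D \<in> \<K> \<Longrightarrow> signed_sum y A D \<le> max_signed y \<K> A"
  unfolding max_signed_def using finK by (intro Max_ge) auto

lemma max_sum_obtains:
  obtains D where "D \<in> \<K>" "max_sum y \<K> A = sum y (A \<inter> D)"
proof -
  have "max_sum y \<K> A \<in> (\<lambda>D. sum y (A \<inter> D)) ` \<K>"
    unfolding max_sum_def using finK neK by (intro Max_in) auto
  then show thesis using that by (elim imageE)
qed

lemma max_signed_obtains:
  obtains D where "D \<in> \<K>" "max_signed y \<K> A = signed_sum y A D"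
proof -
  have "max_signed y \<K> A \<in> signed_sum y A ` \<K>"
    unfolding max_signed_def using finK neK by (intro Max_in) auto
  then show thesis using that by (elim imageE)
qed

lemma finite_member: "D \<in> \<K> \<Longrightarrow> finite D"
  using subK finI by (rule finite_subset)

lemma signed_sum_compl:
  assumes "D \<in> \<K>"
  shows "signed_sum y A D = sum y (A \<inter> D) - sum y ((I - A) \<inter> D)"
proof -
  have "(I - A) \<inter> D = D - A" using subK[OF assms] by auto
  then show ?thesis using signed_sum_eq[OF finite_member[OF assms]] by simp
qed

lemma sum_split_compl:
  assumes "D \<in> \<K>"
  shows "sum y (I \<inter> D) = sum y (A \<inter> D) + sum y ((I - A) \<inter> D)"
proof -
  have "I \<inter> D = (A \<inter> D) \<union> ((I - A) \<inter> D)" using subK[OF assms] by auto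
  then show ?thesis using finite_member[OF assms]
    by (simp add: sum.union_disjoint Int_Diff disjoint_iff)
qed

text \<open>Take \<open>D\<close> maximal for \<open>A\<close>: the sum over
  \<open>(I - A) \<inter> D\<close> is a lower bound for the subtracted maximum, and the difference
  of the two sums is the signed sum over \<open>D\<close>.\<close>

lemma max_sum_diff_le: "max_sum y \<K> A - max_sum y \<K> (I - A) \<le> max_signed y \<K> A"
proof -
  obtain D where D: "D \<in> \<K>" "max_sum y \<K> A = sum y (A \<inter> D)" by (rule max_sum_obtains)
  then show ?thesis
    using sum_le_max_sum[OF D(1), of y "I - A"] signed_le_max_signed[OF D(1), of y A]
      signed_sum_compl[OF D(1), of y A] by linarith
qed

lemma max_sum_le_add: "max_sum y \<K> I \<le> max_sum y \<K> A + max_sum y \<K> (I - A)"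
proof -
  obtain D where D: "D \<in> \<K>" "max_sum y \<K> I = sum y (I \<inter> D)" by (rule max_sum_obtains)
  then show ?thesis
    using sum_le_max_sum[OF D(1), of y "I - A"] sum_le_max_sum[OF D(1), of y A]
      sum_split_compl[OF D(1), of y A] by linarith
qed

text \<open>Twice the sum over \<open>A \<inter> D\<close> is the plain sum over \<open>D\<close>
  plus the signed sum over \<open>D\<close>. With \<open>D\<close> maximal for \<open>A\<close>,
  each summand is bounded by its own maximum.\<close>

lemma max_sum_le_half: "2 * max_sum y \<K> A \<le> max_sum y \<K> I + max_signed y \<K> A"
proof -
  obtain D where D: "D \<in> \<K>" "max_sum y \<K> A = sum y (A \<inter> D)" by (rule max_sum_obtains)
  then show ?thesis
    using sum_le_max_sum[OF D(1), of y I] signed_le_max_signed[OF D(1), of y A]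
      sum_split_compl[OF D(1), of y A] signed_sum_compl[OF D(1), of y A] by linarith
qed

lemma max_sum_mono:
  assumes "\<And>i. i \<in> A \<Longrightarrow> y i \<le> z i"
  shows "max_sum y \<K> A \<le> max_sum z \<K> A"
proof -
  obtain D where D: "D \<in> \<K>" "max_sum y \<K> A = sum y (A \<inter> D)" by (rule max_sum_obtains)
  have "sum y (A \<inter> D) \<le> sum z (A \<inter> D)" using assms by (intro sum_mono) auto
  then show ?thesis using D sum_le_max_sum[OF D(1), of z A] by linarith
qed

text \<open>Exhibits the maximum as a function of the coordinates in \<open>A\<close> alone, the
  form in which \<open>neg_assoc\<close> can be applied to it.\<close>

lemma max_sum_restrict: "max_sum (restrict y A) \<K> A = max_sum y \<K> A"
  by (intro antisym max_sum_mono) auto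

lemma abs_max_sum_le:
  assumes b: "\<And>i. i \<in> I \<Longrightarrow> \<bar>y i\<bar> \<le> b" "0 \<le> b"
  shows "\<bar>max_sum y \<K> A\<bar> \<le> real (card I) * b"
proof -
  obtain D where D: "D \<in> \<K>" "max_sum y \<K> A = sum y (A \<inter> D)" by (rule max_sum_obtains)
  have "\<bar>sum y (A \<inter> D)\<bar> \<le> (\<Sum>i\<in>A \<inter> D. \<bar>y i\<bar>)" by (rule sum_abs)
  also have "\<dots> \<le> (\<Sum>i\<in>I. \<bar>y i\<bar>)" using subK[OF D(1)] finI by (intro sum_mono2) auto
  also have "\<dots> \<le> real (card I) * b" using b by (intro sum_bounded_above) auto
  finally show ?thesis using D by simp
qed

lemma abs_max_signed_le:
  assumes b: "\<And>i. i \<in> I \<Longrightarrow> \<bar>y i\<bar> \<le> b" "0 \<le> b"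
  shows "\<bar>max_signed y \<K> A\<bar> \<le> real (card I) * b"
proof -
  obtain D where D: "D \<in> \<K>" "max_signed y \<K> A = signed_sum y A D" by (rule max_signed_obtains)
  have "\<bar>signed_sum y A D\<bar> \<le> (\<Sum>i\<in>D. \<bar>if i \<in> A then y i else - y i\<bar>)"
    unfolding signed_sum_def by (rule sum_abs)
  also have "\<dots> = (\<Sum>i\<in>D. \<bar>y i\<bar>)" by (intro sum.cong) auto
  also have "\<dots> \<le> (\<Sum>i\<in>I. \<bar>y i\<bar>)" using subK[OF D(1)] finI by (intro sum_mono2) auto
  also have "\<dots> \<le> real (card I) * b" using b by (intro sum_bounded_above) auto
  finally show ?thesis using D by simp
qed

end

lemma sum_exp_max_signed_le:
  fixes \<tau> :: "nat \<Rightarrow> 'i \<Rightarrow> nat"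
  assumes "finite_set_family I \<K>" and s: "0 < s"
    and K: "\<And>D. D \<in> \<K> \<Longrightarrow> \<exists>k. D = {i\<in>I. \<forall>c<d. \<tau> c i \<le> k c}"
  shows "(\<Sum>A\<in>Pow I. exp (s * max_signed y \<K> A)) \<le> 2 ^ d * (\<Sum>A\<in>Pow I. exp (s * signed_sum y A I))"
proof -
  interpret finite_set_family I \<K> by fact
  have "(\<Sum>A\<in>Pow I. exp (s * max_signed y \<K> A))
      \<le> real (2 ^ d) * (\<Sum>A\<in>Pow I. exp (s * signed_sum y A I))"
  proof (rule sum_le_of_card_superlevel_le)
    fix u :: real assume "0 < u"
    \<comment> \<open>Superlevel sets of the exponentials are superlevel sets of the signed sums at
      level \<open>ln u / s\<close>, where the counting inequality applies.\<close>
    then have ln: "u \<le> exp (s * v) \<longleftrightarrow> ln u / s \<le> v" for v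
      using s ln_le_cancel_iff[of u "exp (s * v)"] by (simp add: pos_divide_le_eq mult.commute)
    have "{A\<in>Pow I. u \<le> exp (s * max_signed y \<K> A)}
        \<subseteq> {A\<in>Pow I. \<exists>k. ln u / s \<le> signed_sum y A {i\<in>I. \<forall>c<d. \<tau> c i \<le> k c}}"
    proof
      fix A assume A: "A \<in> {A\<in>Pow I. u \<le> exp (s * max_signed y \<K> A)}"
      obtain D where D: "D \<in> \<K>" "max_signed y \<K> A = signed_sum y A D"
        by (rule max_signed_obtains)
      from K[OF D(1)] obtain k where "D = {i\<in>I. \<forall>c<d. \<tau> c i \<le> k c}" by blast
      with A D(2) show "A \<in> {A\<in>Pow I. \<exists>k. ln u / s \<le> signed_sum y A {i\<in>I. \<forall>c<d. \<tau> c i \<le> k c}}"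
        by (auto simp: ln)
    qed
    then have "card {A\<in>Pow I. u \<le> exp (s * max_signed y \<K> A)}
        \<le> card {A\<in>Pow I. \<exists>k. ln u / s \<le> signed_sum y A {i\<in>I. \<forall>c<d. \<tau> c i \<le> k c}}"
      using finI by (intro card_mono) auto
    also have "\<dots> \<le> 2 ^ d * card {A\<in>Pow I. ln u / s \<le> signed_sum y A I}"
      by (rule card_signed_sum_levy[OF finI])
    finally show "card {A\<in>Pow I. u \<le> exp (s * max_signed y \<K> A)}
        \<le> 2 ^ d * card {A\<in>Pow I. u \<le> exp (s * signed_sum y A I)}"
      by (simp add: ln)
  qed (use finI in auto)
  then show ?thesis by simp
qed


section \<open>Exponential moments under negative association\<close>

lemma (in prob_space) exp_expectation_le:
  fixes X :: "'a \<Rightarrow> real"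
  assumes "integrable M X" "integrable M (\<lambda>\<omega>. exp (X \<omega>))"
  shows "exp (expectation X) \<le> expectation (\<lambda>\<omega>. exp (X \<omega>))"
proof -
  let ?m = "expectation X"
  have "expectation (\<lambda>\<omega>. exp ?m * (1 + (X \<omega> - ?m))) \<le> expectation (\<lambda>\<omega>. exp (X \<omega>))"
  proof (rule integral_mono)
    show "exp ?m * (1 + (X \<omega> - ?m)) \<le> exp (X \<omega>)" for \<omega>
      using mult_left_mono[OF exp_ge_add_one_self[of "X \<omega> - ?m"], of "exp ?m"]
      by (simp add: exp_add[symmetric])
  qed (use assms in auto)
  moreover have "expectation (\<lambda>\<omega>. exp ?m * (1 + (X \<omega> - ?m))) = exp ?m"
    using assms by (simp add: prob_space)
  ultimately show ?thesis by simp
qed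

section \<open>Bounded negatively associated families and their closure under negation\<close>

locale bounded_neg_assoc = prob_space P
  for P :: "'a measure" +
  fixes I :: "'i set" and Y :: "'i \<Rightarrow> 'a \<Rightarrow> real" and b :: real
  assumes finI: "finite I" and na: "neg_assoc P Y I" and b_nonneg: "0 \<le> b"
    and meas [measurable]: "\<And>i. i \<in> I \<Longrightarrow> Y i \<in> borel_measurable P"
    and bounded: "\<And>i. i \<in> I \<Longrightarrow> AE \<omega> in P. \<bar>Y i \<omega>\<bar> \<le> b"
begin

lemma AE_all_bounded: "AE \<omega> in P. \<forall>i\<in>I. \<bar>Y i \<omega>\<bar> \<le> b"
  using finI bounded by (intro AE_finite_allI)

lemma integrable_bounded:
  fixes h :: "'a \<Rightarrow> real"
  assumes "h \<in> borel_measurable P"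
    and "\<And>\<omega>. (\<And>i. i \<in> I \<Longrightarrow> \<bar>Y i \<omega>\<bar> \<le> b) \<Longrightarrow> \<bar>h \<omega>\<bar> \<le> c"
  shows "integrable P h"
  using AE_all_bounded assms by (intro integrable_const_bound[of _ c]) (auto elim!: eventually_mono)

lemma integrable_exp_bounded:
  fixes h :: "'a \<Rightarrow> real"
  assumes [measurable]: "h \<in> borel_measurable P"
    and "\<And>\<omega>. (\<And>i. i \<in> I \<Longrightarrow> \<bar>Y i \<omega>\<bar> \<le> b) \<Longrightarrow> \<bar>h \<omega>\<bar> \<le> c"
  shows "integrable P (\<lambda>\<omega>. exp (s * h \<omega>))"
proof (rule integrable_bounded)
  fix \<omega> assume "\<And>i. i \<in> I \<Longrightarrow> \<bar>Y i \<omega>\<bar> \<le> b"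
  then have "\<bar>h \<omega>\<bar> \<le> c" by (rule assms(2))
  then have "\<bar>s * h \<omega>\<bar> \<le> \<bar>s\<bar> * c" unfolding abs_mult by (rule mult_left_mono) simp
  then show "\<bar>exp (s * h \<omega>)\<bar> \<le> exp (\<bar>s\<bar> * c)" by simp
qed measurable

lemma abs_sum_le:
  assumes "A \<subseteq> I" "\<And>i. i \<in> I \<Longrightarrow> \<bar>Y i \<omega>\<bar> \<le> b"
  shows "\<bar>\<Sum>i\<in>A. Y i \<omega>\<bar> \<le> real (card I) * b"
proof -
  have "\<bar>\<Sum>i\<in>A. Y i \<omega>\<bar> \<le> (\<Sum>i\<in>A. \<bar>Y i \<omega>\<bar>)" by (rule sum_abs)
  also have "\<dots> \<le> (\<Sum>i\<in>I. \<bar>Y i \<omega>\<bar>)" using assms finI by (intro sum_mono2) auto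
  also have "\<dots> \<le> real (card I) * b" using assms by (intro sum_bounded_above) auto
  finally show ?thesis .
qed

lemma measurable_sum:
  assumes "A \<subseteq> I"
  shows "(\<lambda>\<omega>. \<Sum>i\<in>A. Y i \<omega>) \<in> borel_measurable P"
  using assms by (intro borel_measurable_sum meas) auto

lemma integrable_exp_sum: "A \<subseteq> I \<Longrightarrow> integrable P (\<lambda>\<omega>. exp (s * (\<Sum>i\<in>A. Y i \<omega>)))"
  by (rule integrable_exp_bounded[OF measurable_sum abs_sum_le])

lemma expectation_mult_le:
  assumes "A \<subseteq> I" "B \<subseteq> I" "A \<inter> B = {}" "coord_mono A f" "coord_mono B g"
    and "integrable P (\<lambda>\<omega>. f (restrict (\<lambda>i. Y i \<omega>) A))"
    and "integrable P (\<lambda>\<omega>. g (restrict (\<lambda>i. Y i \<omega>) B))"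
    and "integrable P (\<lambda>\<omega>. f (restrict (\<lambda>i. Y i \<omega>) A) * g (restrict (\<lambda>i. Y i \<omega>) B))"
  shows "expectation (\<lambda>\<omega>. f (restrict (\<lambda>i. Y i \<omega>) A) * g (restrict (\<lambda>i. Y i \<omega>) B))
    \<le> expectation (\<lambda>\<omega>. f (restrict (\<lambda>i. Y i \<omega>) A)) * expectation (\<lambda>\<omega>. g (restrict (\<lambda>i. Y i \<omega>) B))"
proof -
  have "expectation (\<lambda>\<omega>. f (restrict (\<lambda>i. Y i \<omega>) A) * g (restrict (\<lambda>i. Y i \<omega>) B))
    - expectation (\<lambda>\<omega>. f (restrict (\<lambda>i. Y i \<omega>) A)) * expectation (\<lambda>\<omega>. g (restrict (\<lambda>i. Y i \<omega>) B)) \<le> 0"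
    using assms by (intro na[unfolded neg_assoc_def, rule_format]) blast
  then show ?thesis by simp
qed

lemma uminus: "bounded_neg_assoc P I (\<lambda>i \<omega>. - Y i \<omega>) b"
proof unfold_locales
  show "neg_assoc P (\<lambda>i \<omega>. - Y i \<omega>) I"
    unfolding neg_assoc_def
  proof (intro allI impI, elim conjE)
    fix A B f g
    \<comment> \<open>Reversing the arguments makes \<open>h\<close> nonincreasing and the outer
      minus restores monotonicity; the two outer signs cancel in the covariance. The inner
      restriction keeps the argument extensional on \<open>C\<close>, as \<open>coord_mono\<close>
      requires.\<close>
    define neg where "neg C h x = - h (\<lambda>i\<in>C. - x i)" for C :: "'i set" and h :: "('i \<Rightarrow> real) \<Rightarrow> real" and x
    have mono: "coord_mono C (neg C h)" if "coord_mono C h" for C h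
      using that unfolding coord_mono_def neg_def by (auto simp: le_minus_iff)
    have neg: "neg C h (restrict (\<lambda>i. Y i \<omega>) C) = - h (restrict (\<lambda>i. - Y i \<omega>) C)" for C h \<omega>
      unfolding neg_def by (simp cong: restrict_cong)
    assume a: "A \<subseteq> I" "B \<subseteq> I" "A \<inter> B = {}" "coord_mono A f" "coord_mono B g"
      "integrable P (\<lambda>\<omega>. f (restrict (\<lambda>i. - Y i \<omega>) A))"
      "integrable P (\<lambda>\<omega>. g (restrict (\<lambda>i. - Y i \<omega>) B))"
      "integrable P (\<lambda>\<omega>. f (restrict (\<lambda>i. - Y i \<omega>) A) * g (restrict (\<lambda>i. - Y i \<omega>) B))"
    then show "expectation (\<lambda>\<omega>. f (restrict (\<lambda>i. - Y i \<omega>) A) * g (restrict (\<lambda>i. - Y i \<omega>) B))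
      - expectation (\<lambda>\<omega>. f (restrict (\<lambda>i. - Y i \<omega>) A)) * expectation (\<lambda>\<omega>. g (restrict (\<lambda>i. - Y i \<omega>) B)) \<le> 0"
      using expectation_mult_le[OF a(1-3) mono[OF a(4)] mono[OF a(5)]] by (simp add: neg)
  qed
qed (use finI b_nonneg bounded in auto)

end

section \<open>Bernstein-type bounds for exponential moments of sums\<close>

lemma exp_le_quadratic:
  fixes u :: real
  assumes "\<bar>u\<bar> \<le> 1"
  shows "exp u \<le> 1 + u + u\<^sup>2"
proof (cases "0 \<le> u")
  case True
  then show ?thesis using assms exp_bound[of u] by simp
next
  case False
  define v where "v = - u"
  have v: "0 \<le> v" using False by (simp add: v_def)
  have pos: "0 \<le> 1 - v + v\<^sup>2"
    using zero_le_power2[of "v - 1/2"] by (simp add: power2_eq_square algebra_simps)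
  have "1 \<le> 1 + v\<^sup>2 / 2 + v ^ 3 / 2 + v ^ 4 / 2" using v by simp
  \<comment> \<open>The claim for \<open>u = - v\<close> amounts to
    \<open>(1 - v + v^2) * exp v\<close> being at least 1, so the quadratic Taylor lower bound for
    \<open>exp v\<close> is multiplied in.\<close>
  also have "\<dots> = (1 - v + v\<^sup>2) * (1 + v + v\<^sup>2 / 2)"
    by (simp add: field_simps power2_eq_square power3_eq_cube power4_eq_xxxx)
  also have "\<dots> \<le> (1 - v + v\<^sup>2) * exp v"
    using exp_lower_Taylor_quadratic[OF v] pos by (rule mult_left_mono)
  finally show ?thesis by (simp add: v_def exp_minus field_simps)
qed

context bounded_neg_assoc
begin

text \<open>For nonnegative \<open>r\<close> the exponentials of sums over disjoint sets are
  nondecreasing, so negative association lets the variables be split off one by one as if they were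
  independent. Each factor is controlled by the quadratic bound, whose linear term vanishes because
  the mean is zero.\<close>

lemma expectation_exp_sum_le_pos:
  assumes mean: "\<And>i. i \<in> I \<Longrightarrow> expectation (Y i) = 0" and r: "0 \<le> r" "r * b \<le> 1"
    and A: "A \<subseteq> I"
  shows "expectation (\<lambda>\<omega>. exp (r * (\<Sum>i\<in>A. Y i \<omega>)))
    \<le> exp (r\<^sup>2 * (\<Sum>i\<in>A. expectation (\<lambda>\<omega>. (Y i \<omega>)\<^sup>2)))"
proof -
  have "finite A" using A finI by (rule finite_subset)
  then show ?thesis using A
  proof (induction A rule: finite_induct)
    case empty
    then show ?case by (simp add: prob_space)
  next
    case (insert a A)
    have aI: "{a} \<subseteq> I" "a \<in> I" and AI: "A \<subseteq> I" using insert.prems by auto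
    have sum_a: "(\<Sum>i\<in>{a}. Y i \<omega>) = Y a \<omega>" for \<omega> by simp
    have int1: "integrable P (Y a)"
      by (rule integrable_bounded[of _ b]) (use aI in auto)
    have int2: "integrable P (\<lambda>\<omega>. (Y a \<omega>)\<^sup>2)"
    proof (rule integrable_bounded)
      fix \<omega> assume "\<And>i. i \<in> I \<Longrightarrow> \<bar>Y i \<omega>\<bar> \<le> b"
      then show "\<bar>(Y a \<omega>)\<^sup>2\<bar> \<le> b\<^sup>2" using power_mono[of "\<bar>Y a \<omega>\<bar>" b 2] aI by simp
    qed (use aI in measurable)
    have "expectation (\<lambda>\<omega>. exp (r * Y a \<omega>)) \<le> expectation (\<lambda>\<omega>. 1 + r * Y a \<omega> + r\<^sup>2 * (Y a \<omega>)\<^sup>2)"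
    proof (rule integral_mono_AE)
      show "integrable P (\<lambda>\<omega>. exp (r * Y a \<omega>))" using integrable_exp_sum[OF aI(1), of r] by simp
      show "integrable P (\<lambda>\<omega>. 1 + r * Y a \<omega> + r\<^sup>2 * (Y a \<omega>)\<^sup>2)" using int1 int2 by simp
      show "AE \<omega> in P. exp (r * Y a \<omega>) \<le> 1 + r * Y a \<omega> + r\<^sup>2 * (Y a \<omega>)\<^sup>2"
        using bounded[OF aI(2)]
      proof eventually_elim
        case (elim \<omega>)
        have "\<bar>r * Y a \<omega>\<bar> \<le> r * b" using mult_left_mono[OF elim r(1)] r(1) by (simp add: abs_mult)
        then show ?case using exp_le_quadratic[of "r * Y a \<omega>"] r(2) by (simp add: power_mult_distrib)
      qed
    qed
    also have "\<dots> = 1 + r\<^sup>2 * expectation (\<lambda>\<omega>. (Y a \<omega>)\<^sup>2)"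
      using int1 int2 mean[OF aI(2)] by (simp add: prob_space)
    also have "\<dots> \<le> exp (r\<^sup>2 * expectation (\<lambda>\<omega>. (Y a \<omega>)\<^sup>2))" by (rule exp_ge_add_one_self)
    finally have one: "expectation (\<lambda>\<omega>. exp (r * Y a \<omega>)) \<le> exp (r\<^sup>2 * expectation (\<lambda>\<omega>. (Y a \<omega>)\<^sup>2))" .
    define f where "f C x = exp (r * (\<Sum>i\<in>C. x i))" for C :: "'i set" and x :: "'i \<Rightarrow> real"
    have f_restrict: "f C (restrict (\<lambda>i. Y i \<omega>) C) = exp (r * (\<Sum>i\<in>C. Y i \<omega>))" for C \<omega>
      by (simp add: f_def)
    have f_mono: "coord_mono C (f C)" for C
      unfolding coord_mono_def f_def using r(1) by (auto intro!: mult_left_mono sum_mono)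
    have split: "exp (r * (\<Sum>i\<in>insert a A. Y i \<omega>)) = exp (r * Y a \<omega>) * exp (r * (\<Sum>i\<in>A. Y i \<omega>))" for \<omega>
      using insert.hyps by (simp add: distrib_left exp_add)
    have "expectation (\<lambda>\<omega>. exp (r * (\<Sum>i\<in>insert a A. Y i \<omega>)))
        \<le> expectation (\<lambda>\<omega>. exp (r * Y a \<omega>)) * expectation (\<lambda>\<omega>. exp (r * (\<Sum>i\<in>A. Y i \<omega>)))"
      using expectation_mult_le[OF aI(1) AI _ f_mono f_mono]
        integrable_exp_sum[OF aI(1), of r] integrable_exp_sum[OF AI, of r]
        integrable_exp_sum[OF insert.prems, of r] insert.hyps(2)
      unfolding f_restrict sum_a split by simp
    also have "\<dots> \<le> exp (r\<^sup>2 * expectation (\<lambda>\<omega>. (Y a \<omega>)\<^sup>2))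
        * exp (r\<^sup>2 * (\<Sum>i\<in>A. expectation (\<lambda>\<omega>. (Y i \<omega>)\<^sup>2)))"
      using one insert.IH[OF AI] by (intro mult_mono) auto
    also have "\<dots> = exp (r\<^sup>2 * (\<Sum>i\<in>insert a A. expectation (\<lambda>\<omega>. (Y i \<omega>)\<^sup>2)))"
      using insert.hyps by (simp add: distrib_left exp_add)
    finally show ?case .
  qed
qed

text \<open>Negative \<open>r\<close> is reduced to the positive case by passing to
  \<open>- Y\<close>. The variance sum is enlarged to all of \<open>I\<close> so that the bound is
  uniform in \<open>A\<close>.\<close>

lemma expectation_exp_sum_le:
  assumes mean: "\<And>i. i \<in> I \<Longrightarrow> expectation (Y i) = 0" and r: "\<bar>r\<bar> * b \<le> 1" and A: "A \<subseteq> I"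
  shows "expectation (\<lambda>\<omega>. exp (r * (\<Sum>i\<in>A. Y i \<omega>)))
    \<le> exp (r\<^sup>2 * (\<Sum>i\<in>I. expectation (\<lambda>\<omega>. (Y i \<omega>)\<^sup>2)))"
proof -
  have "expectation (\<lambda>\<omega>. exp (r * (\<Sum>i\<in>A. Y i \<omega>)))
    \<le> exp (r\<^sup>2 * (\<Sum>i\<in>A. expectation (\<lambda>\<omega>. (Y i \<omega>)\<^sup>2)))"
  proof (cases "0 \<le> r")
    case True
    then show ?thesis using expectation_exp_sum_le_pos[OF mean True _ A] r by simp
  next
    case False
    interpret neg: bounded_neg_assoc P I "\<lambda>i \<omega>. - Y i \<omega>" b by (rule uminus)
    show ?thesis using neg.expectation_exp_sum_le_pos[of "- r" A] mean A r False
      by (simp add: sum_negf)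
  qed
  also have "\<dots> \<le> exp (r\<^sup>2 * (\<Sum>i\<in>I. expectation (\<lambda>\<omega>. (Y i \<omega>)\<^sup>2)))"
    using finI A by (auto intro!: mult_left_mono sum_mono2)
  finally show ?thesis .
qed

end


section \<open>Decoupling of the maximum by random subsets\<close>

locale bounded_neg_assoc_family = bounded_neg_assoc P I Y b + finite_set_family I \<K>
  for P :: "'a measure" and I :: "'i set" and Y b \<K>
begin

abbreviation F :: "'i set \<Rightarrow> 'a \<Rightarrow> real" where "F A \<omega> \<equiv> max_sum (\<lambda>i. Y i \<omega>) \<K> A"
abbreviation G :: "'i set \<Rightarrow> 'a \<Rightarrow> real" where "G A \<omega> \<equiv> max_signed (\<lambda>i. Y i \<omega>) \<K> A"

lemma measurable_F: "A \<subseteq> I \<Longrightarrow> F A \<in> borel_measurable P"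
  unfolding max_sum_def using finK by (intro borel_measurable_Max measurable_sum) auto

lemma measurable_G: "A \<subseteq> I \<Longrightarrow> G A \<in> borel_measurable P"
proof -
  have [measurable]: "(\<lambda>\<omega>. \<Sum>i\<in>D. if i \<in> A then Y i \<omega> else - Y i \<omega>) \<in> borel_measurable P"
    if "D \<in> \<K>" for D
  proof (rule borel_measurable_sum)
    fix i assume "i \<in> D"
    then have "i \<in> I" using subK[OF that] by auto
    then show "(\<lambda>\<omega>. if i \<in> A then Y i \<omega> else - Y i \<omega>) \<in> borel_measurable P" by simp
  qed
  show ?thesis
    unfolding max_signed_def signed_sum_def using finK by (intro borel_measurable_Max) auto
qed

lemma abs_F_le: "(\<And>i. i \<in> I \<Longrightarrow> \<bar>Y i \<omega>\<bar> \<le> b) \<Longrightarrow> \<bar>F A \<omega>\<bar> \<le> real (card I) * b"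
  using b_nonneg by (intro abs_max_sum_le) auto

lemma abs_G_le: "(\<And>i. i \<in> I \<Longrightarrow> \<bar>Y i \<omega>\<bar> \<le> b) \<Longrightarrow> \<bar>G A \<omega>\<bar> \<le> real (card I) * b"
  using b_nonneg by (intro abs_max_signed_le) auto

lemma integrable_F: "A \<subseteq> I \<Longrightarrow> integrable P (F A)"
  by (rule integrable_bounded[OF measurable_F abs_F_le])

lemma integrable_G: "A \<subseteq> I \<Longrightarrow> integrable P (G A)"
  by (rule integrable_bounded[OF measurable_G abs_G_le])

lemma integrable_exp_F: "A \<subseteq> I \<Longrightarrow> integrable P (\<lambda>\<omega>. exp (s * F A \<omega>))"
  by (rule integrable_exp_bounded[OF measurable_F abs_F_le])

lemma integrable_exp_G: "A \<subseteq> I \<Longrightarrow> integrable P (\<lambda>\<omega>. exp (s * G A \<omega>))"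
  by (rule integrable_exp_bounded[OF measurable_G abs_G_le])

text \<open>Jensen's inequality replaces the constant \<open>expectation (F (I - A))\<close> by the
  random \<open>F (I - A)\<close>; negative association then merges the product of expectations into
  one expectation of the exponential of \<open>F A - F (I - A)\<close>, which \<open>G A\<close>
  dominates.\<close>

lemma expectation_exp_F_centered_le:
  assumes A: "A \<subseteq> I" and s: "0 \<le> s"
  shows "expectation (\<lambda>\<omega>. exp (s * (F A \<omega> - expectation (F (I - A)))))
    \<le> expectation (\<lambda>\<omega>. exp (s * G A \<omega>))"
proof -
  let ?B = "I - A"
  have B: "?B \<subseteq> I" by auto
  define f where "f x = exp (s * max_sum x \<K> A)" for x
  \<comment> \<open>The leading minus makes the decreasing exponential nondecreasing. It also
    reverses the covariance inequality: the product of the expectations of the two exponentials is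
    at most the expectation of their product.\<close>
  define g where "g x = - exp (- s * max_sum x \<K> ?B)" for x
  have f: "f (restrict (\<lambda>i. Y i \<omega>) A) = exp (s * F A \<omega>)" for \<omega>
    by (simp add: f_def max_sum_restrict)
  have g: "g (restrict (\<lambda>i. Y i \<omega>) ?B) = - exp (- s * F ?B \<omega>)" for \<omega>
    by (simp add: g_def max_sum_restrict)
  have f_mono: "coord_mono A f"
    unfolding coord_mono_def f_def using s by (auto intro!: mult_left_mono max_sum_mono)
  have g_mono: "coord_mono ?B g"
    unfolding coord_mono_def g_def using s by (auto intro!: mult_left_mono max_sum_mono)
  have diff: "exp (s * F A \<omega>) * exp (- s * F ?B \<omega>) = exp (s * (F A \<omega> - F ?B \<omega>))" for \<omega>
    by (simp add: exp_add[symmetric] algebra_simps)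
  have int_diff: "integrable P (\<lambda>\<omega>. exp (s * (F A \<omega> - F ?B \<omega>)))"
  proof (rule integrable_exp_bounded)
    show "(\<lambda>\<omega>. F A \<omega> - F ?B \<omega>) \<in> borel_measurable P"
      using measurable_F[OF A] measurable_F[OF B] by simp
    show "\<bar>F A \<omega> - F ?B \<omega>\<bar> \<le> 2 * (real (card I) * b)"
      if "\<And>i. i \<in> I \<Longrightarrow> \<bar>Y i \<omega>\<bar> \<le> b" for \<omega>
      using abs_F_le[OF that, of A] abs_F_le[OF that, of ?B] by linarith
  qed
  have "exp (- s * expectation (F ?B)) \<le> expectation (\<lambda>\<omega>. exp (- s * F ?B \<omega>))"
    using exp_expectation_le[of "\<lambda>\<omega>. - s * F ?B \<omega>"] integrable_F[OF B] integrable_exp_F[OF B, of "- s"]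
    by simp
  then have "expectation (\<lambda>\<omega>. exp (s * F A \<omega>)) * exp (- s * expectation (F ?B))
      \<le> expectation (\<lambda>\<omega>. exp (s * F A \<omega>)) * expectation (\<lambda>\<omega>. exp (- s * F ?B \<omega>))"
    by (rule mult_left_mono) simp
  also have "\<dots> \<le> expectation (\<lambda>\<omega>. exp (s * F A \<omega>) * exp (- s * F ?B \<omega>))"
    using expectation_mult_le[OF A B _ f_mono g_mono] integrable_exp_F[OF A, of s]
      integrable_exp_F[OF B, of "- s"] int_diff
    unfolding f g by (simp add: diff[simplified])
  also have "\<dots> \<le> expectation (\<lambda>\<omega>. exp (s * G A \<omega>))"
    unfolding diff using int_diff integrable_exp_G[OF A] s
    by (intro integral_mono) (auto intro!: mult_left_mono max_sum_diff_le)
  also have "expectation (\<lambda>\<omega>. exp (s * F A \<omega>)) * exp (- s * expectation (F ?B))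
      = expectation (\<lambda>\<omega>. exp (s * (F A \<omega> - expectation (F ?B))))"
    by (subst integral_mult_left_zero[symmetric]) (simp add: exp_add[symmetric] algebra_simps)
  finally show ?thesis .
qed

text \<open>Joint expectation over the field and an independent uniform \<open>A\<close>, written as
  a finite average so that no product space is introduced.\<close>

definition mean_exp_G :: "real \<Rightarrow> real" where
  "mean_exp_G s = (\<Sum>A\<in>Pow I. expectation (\<lambda>\<omega>. exp (s * G A \<omega>))) / 2 ^ card I"

definition mean_G :: real where
  "mean_G = (\<Sum>A\<in>Pow I. expectation (G A)) / 2 ^ card I"

text \<open>Jensen's inequality twice, first for the average over \<open>A\<close> and then for each
  expectation. It bounds the first moment of \<open>G\<close> by the same exponential moment that
  controls the tail.\<close>

lemma exp_mean_G_le: "exp (s * mean_G) \<le> mean_exp_G s"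
proof -
  have c: "real (card (Pow I)) = 2 ^ card I" by (rule card_Pow_real[OF finI])
  have "2 ^ card I * exp (s * mean_G) \<le> (\<Sum>A\<in>Pow I. exp (s * expectation (G A)))"
    using exp_mean_le[of "Pow I" "\<lambda>A. s * expectation (G A)"] finI
    unfolding c mean_G_def by (simp add: sum_distrib_left[symmetric] Pow_not_empty)
  also have "\<dots> \<le> (\<Sum>A\<in>Pow I. expectation (\<lambda>\<omega>. exp (s * G A \<omega>)))"
  proof (rule sum_mono)
    fix A assume "A \<in> Pow I"
    then show "exp (s * expectation (G A)) \<le> expectation (\<lambda>\<omega>. exp (s * G A \<omega>))"
      using exp_expectation_le[of "\<lambda>\<omega>. s * G A \<omega>"] integrable_G[of A] integrable_exp_G[of A s] by simp
  qed
  finally show ?thesis by (simp add: mean_exp_G_def field_simps)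
qed

text \<open>The decoupled bound for each \<open>A\<close> is averaged. By Jensen's inequality over
  \<open>A\<close> it suffices to bound the average of the exponents from below, where only half of
  \<open>F I\<close> survives; hence \<open>s / 2\<close> on the left against \<open>s\<close> on
  the right.\<close>

lemma expectation_exp_F_le:
  assumes s: "0 \<le> s"
  shows "expectation (\<lambda>\<omega>. exp (s / 2 * (F I \<omega> - expectation (F I)))) \<le> exp (s / 2 * mean_G) * mean_exp_G s"
proof -
  let ?N = "2 ^ card I :: real"
  define z where "z \<omega> A = s * (F A \<omega> - expectation (F (I - A)))" for \<omega> A
  have c: "real (card (Pow I)) = ?N" by (rule card_Pow_real[OF finI])
  \<comment> \<open>The centering terms must be bounded from above, and subadditivity gives only
    lower bounds for them. \<open>max_sum_le_half\<close> supplies an upper bound at the cost of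
    \<open>mean_G\<close>.\<close>
  have EF: "(\<Sum>A\<in>Pow I. expectation (F (I - A))) \<le> ?N / 2 * (expectation (F I) + mean_G)"
  proof -
    have "2 * expectation (F A) \<le> expectation (F I) + expectation (G A)" if "A \<subseteq> I" for A
    proof -
      have "expectation (\<lambda>\<omega>. 2 * F A \<omega>) \<le> expectation (\<lambda>\<omega>. F I \<omega> + G A \<omega>)"
        using integrable_F[OF that] integrable_F[of I] integrable_G[OF that]
        by (intro integral_mono max_sum_le_half) auto
      then show ?thesis using integrable_F[of I] integrable_G[OF that] by simp
    qed
    then have "(\<Sum>A\<in>Pow I. 2 * expectation (F A)) \<le> (\<Sum>A\<in>Pow I. expectation (F I) + expectation (G A))"
      by (intro sum_mono) auto
    also have "\<dots> = ?N * (expectation (F I) + mean_G)"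
      by (simp add: sum.distrib c distrib_left mean_G_def)
    finally show ?thesis
      by (simp add: sum_Pow_compl[of "\<lambda>A. expectation (F A)"] sum_distrib_left[symmetric])
  qed
  \<comment> \<open>Each \<open>A\<close> is paired with its complement, which is again uniformly
    distributed.\<close>
  have F: "?N / 2 * F I \<omega> \<le> (\<Sum>A\<in>Pow I. F A \<omega>)" for \<omega>
  proof -
    have "?N * F I \<omega> = (\<Sum>A\<in>Pow I. F I \<omega>)" by (simp add: c)
    also have "\<dots> \<le> (\<Sum>A\<in>Pow I. F A \<omega> + F (I - A) \<omega>)"
      by (intro sum_mono max_sum_le_add)
    also have "\<dots> = 2 * (\<Sum>A\<in>Pow I. F A \<omega>)"
      by (simp add: sum.distrib sum_Pow_compl[of "\<lambda>A. F A \<omega>"])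
    finally show ?thesis by simp
  qed
  have point: "?N * exp (s / 2 * (F I \<omega> - expectation (F I) - mean_G)) \<le> (\<Sum>A\<in>Pow I. exp (z \<omega> A))" for \<omega>
  proof -
    have "sum (z \<omega>) (Pow I) = s * ((\<Sum>A\<in>Pow I. F A \<omega>) - (\<Sum>A\<in>Pow I. expectation (F (I - A))))"
      by (simp add: z_def sum_distrib_left[symmetric] sum_subtractf)
    also have "\<dots> \<ge> s * (?N / 2 * F I \<omega> - ?N / 2 * (expectation (F I) + mean_G))"
      using F[of \<omega>] EF s by (intro mult_left_mono) linarith+
    finally have "s / 2 * (F I \<omega> - expectation (F I) - mean_G) \<le> sum (z \<omega>) (Pow I) / ?N"
      by (simp add: field_simps)
    then have "?N * exp (s / 2 * (F I \<omega> - expectation (F I) - mean_G)) \<le> ?N * exp (sum (z \<omega>) (Pow I) / ?N)"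
      by simp
    also have "\<dots> \<le> (\<Sum>A\<in>Pow I. exp (z \<omega> A))"
      using exp_mean_le[of "Pow I" "z \<omega>"] finI by (simp add: c Pow_not_empty)
    finally show ?thesis .
  qed
  have shift: "exp (t * (F A \<omega> - m)) = exp (t * F A \<omega>) * exp (- t * m)" for t A \<omega> m
    by (simp add: exp_add[symmetric] algebra_simps)
  have int_z: "integrable P (\<lambda>\<omega>. exp (z \<omega> A))" if "A \<subseteq> I" for A
    using integrable_exp_F[OF that, of s] unfolding z_def shift by (rule integrable_mult_left)
  have int_F: "integrable P (\<lambda>\<omega>. exp (s / 2 * (F I \<omega> - m)))" for m
    using integrable_exp_F[of I "s / 2"] unfolding shift by (intro integrable_mult_left) simp
  have "?N * expectation (\<lambda>\<omega>. exp (s / 2 * (F I \<omega> - (expectation (F I) + mean_G))))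
      = expectation (\<lambda>\<omega>. ?N * exp (s / 2 * (F I \<omega> - (expectation (F I) + mean_G))))" by simp
  also have "\<dots> \<le> expectation (\<lambda>\<omega>. \<Sum>A\<in>Pow I. exp (z \<omega> A))"
    using point int_z int_F by (intro integral_mono) (auto simp: diff_diff_eq)
  also have "\<dots> = (\<Sum>A\<in>Pow I. expectation (\<lambda>\<omega>. exp (z \<omega> A)))"
    using int_z by (intro Bochner_Integration.integral_sum) auto
  also have "\<dots> \<le> (\<Sum>A\<in>Pow I. expectation (\<lambda>\<omega>. exp (s * G A \<omega>)))"
    unfolding z_def using s by (intro sum_mono expectation_exp_F_centered_le) auto
  finally have "expectation (\<lambda>\<omega>. exp (s / 2 * (F I \<omega> - (expectation (F I) + mean_G)))) \<le> mean_exp_G s"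
    by (simp add: mean_exp_G_def field_simps)
  moreover have "exp (s / 2 * mean_G) * expectation (\<lambda>\<omega>. exp (s / 2 * (F I \<omega> - (expectation (F I) + mean_G))))
      = expectation (\<lambda>\<omega>. exp (s / 2 * (F I \<omega> - expectation (F I))))"
    by (subst integral_mult_right_zero[symmetric]) (simp add: exp_add[symmetric] algebra_simps)
  ultimately show ?thesis by (metis exp_ge_zero mult_left_mono)
qed

text \<open>For fixed values of the field the average over \<open>A\<close> is a Rademacher average,
  so Levy's inequality replaces the maximum by the signed sum over all of \<open>I\<close>. Only
  afterwards is the expectation taken and negative association used.\<close>

lemma mean_exp_G_le:
  fixes \<tau> :: "nat \<Rightarrow> 'i \<Rightarrow> nat"
  assumes s: "0 < s" "2 * s * b \<le> 1"
    and mean: "\<And>i. i \<in> I \<Longrightarrow> expectation (Y i) = 0"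
    and K: "\<And>D. D \<in> \<K> \<Longrightarrow> \<exists>k. D = {i\<in>I. \<forall>c<d. \<tau> c i \<le> k c}"
  shows "mean_exp_G s \<le> 2 ^ d * exp ((2 * s)\<^sup>2 * (\<Sum>i\<in>I. expectation (\<lambda>\<omega>. (Y i \<omega>)\<^sup>2)))"
    (is "_ \<le> 2 ^ d * ?V")
proof -
  let ?E = "\<lambda>t A \<omega>. exp (t * (\<Sum>i\<in>A. Y i \<omega>))"
  have c: "real (card (Pow I)) = 2 ^ card I" by (rule card_Pow_real[OF finI])
  \<comment> \<open>The sums over \<open>A\<close> and \<open>I - A\<close> enter with opposite
    signs, so for the product of their exponentials negative association gives a lower bound only.
    The inequality between geometric and arithmetic mean separates them at the price of doubling the
    exponent, which is why \<open>2 * s * b\<close> must be at most 1.\<close>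
  have amgm: "exp (s * signed_sum (\<lambda>i. Y i \<omega>) A I) \<le> (?E (2 * s) A \<omega> + ?E (- (2 * s)) (I - A) \<omega>) / 2"
    if "A \<subseteq> I" for A \<omega>
  proof -
    let ?a = "exp (s * (\<Sum>i\<in>A. Y i \<omega>))" and ?b = "exp (- s * (\<Sum>i\<in>I - A. Y i \<omega>))"
    have eq: "signed_sum (\<lambda>i. Y i \<omega>) A I = (\<Sum>i\<in>A. Y i \<omega>) - (\<Sum>i\<in>I - A. Y i \<omega>)"
      using signed_sum_eq[OF finI, of "\<lambda>i. Y i \<omega>" A] that by (simp add: Int_absorb2)
    have "exp (s * signed_sum (\<lambda>i. Y i \<omega>) A I) = ?a * ?b"
      unfolding eq by (simp add: exp_add[symmetric] right_diff_distrib)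
    also have "\<dots> \<le> (?a\<^sup>2 + ?b\<^sup>2) / 2" using sum_squares_bound[of ?a ?b] by simp
    also have "\<dots> = (?E (2 * s) A \<omega> + ?E (- (2 * s)) (I - A) \<omega>) / 2"
      using exp_double[of "s * (\<Sum>i\<in>A. Y i \<omega>)"] exp_double[of "- s * (\<Sum>i\<in>I - A. Y i \<omega>)"]
      by (simp add: mult.assoc)
    finally show ?thesis .
  qed
  have E_le: "expectation (?E t A) \<le> ?V" if "\<bar>t\<bar> = 2 * s" "A \<subseteq> I" for t A
  proof -
    have "t\<^sup>2 = (2 * s)\<^sup>2" using that(1) by (metis power2_abs)
    then show ?thesis using expectation_exp_sum_le[OF mean _ that(2), of t] that s by simp
  qed
  define H where "H A \<omega> = (?E (2 * s) A \<omega> + ?E (- (2 * s)) (I - A) \<omega>) / 2" for A \<omega>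
  have int_E: "integrable P (?E t A)" if "A \<subseteq> I" for t A
    by (rule integrable_exp_sum[OF that])
  have int_H: "integrable P (H A)" if "A \<subseteq> I" for A
    unfolding H_def
    by (intro integrable_divide Bochner_Integration.integrable_add int_E) (use that in auto)
  have E_H: "expectation (H A) \<le> ?V" if A: "A \<subseteq> I" for A
  proof -
    have "expectation (H A) = (expectation (?E (2 * s) A) + expectation (?E (- (2 * s)) (I - A))) / 2"
      unfolding H_def
      using Bochner_Integration.integral_add[OF int_E[OF A, of "2 * s"] int_E[of "I - A" "- (2 * s)"]]
      by simp
    also have "\<dots> \<le> ?V"
      using E_le[of "2 * s" A] E_le[of "- (2 * s)" "I - A"] A s(1) by simp
    finally show ?thesis .
  qed
  have "2 ^ card I * mean_exp_G s = expectation (\<lambda>\<omega>. \<Sum>A\<in>Pow I. exp (s * G A \<omega>))"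
    unfolding mean_exp_G_def using integrable_exp_G
    by (subst Bochner_Integration.integral_sum) auto
  also have "\<dots> \<le> expectation (\<lambda>\<omega>. 2 ^ d * (\<Sum>A\<in>Pow I. H A \<omega>))"
  proof (rule integral_mono)
    fix \<omega>
    have "(\<Sum>A\<in>Pow I. exp (s * G A \<omega>)) \<le> 2 ^ d * (\<Sum>A\<in>Pow I. exp (s * signed_sum (\<lambda>i. Y i \<omega>) A I))"
      by (rule sum_exp_max_signed_le[OF finite_set_family_axioms s(1) K])
    also have "\<dots> \<le> 2 ^ d * (\<Sum>A\<in>Pow I. H A \<omega>)"
      using amgm by (intro mult_left_mono sum_mono) (auto simp: H_def)
    finally show "(\<Sum>A\<in>Pow I. exp (s * G A \<omega>)) \<le> 2 ^ d * (\<Sum>A\<in>Pow I. H A \<omega>)" .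
  next
    show "integrable P (\<lambda>\<omega>. \<Sum>A\<in>Pow I. exp (s * G A \<omega>))"
      using integrable_exp_G by (intro Bochner_Integration.integrable_sum) auto
    show "integrable P (\<lambda>\<omega>. 2 ^ d * (\<Sum>A\<in>Pow I. H A \<omega>))"
      using int_H by (intro integrable_mult_right Bochner_Integration.integrable_sum) auto
  qed
  also have "\<dots> = 2 ^ d * (\<Sum>A\<in>Pow I. expectation (H A))"
    using int_H by (subst integral_mult_right_zero, subst Bochner_Integration.integral_sum) auto
  also have "\<dots> \<le> 2 ^ d * (\<Sum>A\<in>Pow I. ?V)"
    using E_H by (intro mult_left_mono sum_mono) auto
  also have "\<dots> = 2 ^ card I * (2 ^ d * ?V)" by (simp add: c)
  finally show ?thesis by simp
qed

lemma prob_F_ge_le: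
  fixes \<tau> :: "nat \<Rightarrow> 'i \<Rightarrow> nat" and x :: real
  assumes b: "0 < b" and x: "0 < x"
    and mean: "\<And>i. i \<in> I \<Longrightarrow> expectation (Y i) = 0"
    and K: "\<And>D. D \<in> \<K> \<Longrightarrow> \<exists>k. D = {i\<in>I. \<forall>c<d. \<tau> c i \<le> k c}"
    and Q: "Q = x\<^sup>2 / (2 * (b * x + (\<Sum>i\<in>I. expectation (\<lambda>\<omega>. (Y i \<omega>)\<^sup>2))))"
    and d: "2 ^ d \<le> exp Q"
  shows "prob {\<omega>\<in>space P. 20 * x \<le> F I \<omega> - expectation (F I)} \<le> 2 ^ d * exp (- Q)"
proof -
  define V where "V = (\<Sum>i\<in>I. expectation (\<lambda>\<omega>. (Y i \<omega>)\<^sup>2))"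
  have V: "0 \<le> V" by (simp add: V_def sum_nonneg)
  define w where "w = b * x + V"
  have w: "0 < w" "b * x \<le> w" "V \<le> w" using b x V by (auto simp: w_def add_pos_nonneg)
  \<comment> \<open>This choice gives \<open>s * x = Q\<close>, meets
    \<open>2 * s * b \<le> 1\<close> because \<open>b * x \<le> w\<close>, and makes the variance
    exponent at most \<open>2 * Q\<close> because \<open>V \<le> w\<close>.\<close>
  define s where "s = x / (2 * w)"
  have s: "0 < s" "2 * s * b \<le> 1" using x w by (auto simp: s_def field_simps)
  have Qw: "Q = x\<^sup>2 / (2 * w)" using Q by (simp add: w_def V_def)
  have sx: "s * x = Q" by (simp add: s_def Qw power2_eq_square)
  have Q0: "0 \<le> Q" using w by (simp add: Qw)
  have "(2 * s)\<^sup>2 * V \<le> (2 * s)\<^sup>2 * w" using w by (intro mult_left_mono) auto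
  also have "\<dots> = 2 * Q" using w by (simp add: s_def Qw power2_eq_square field_simps)
  finally have sV: "(2 * s)\<^sup>2 * V \<le> 2 * Q" .
  define L where "L = 2 ^ d * exp (2 * Q)"
  have "mean_exp_G s \<le> 2 ^ d * exp ((2 * s)\<^sup>2 * V)"
    unfolding V_def by (rule mean_exp_G_le[OF s mean K])
  also have "\<dots> \<le> L" unfolding L_def using sV by simp
  finally have GL: "mean_exp_G s \<le> L" .
  have L1: "1 \<le> L"
    unfolding L_def using mult_mono[of 1 "2 ^ d" 1 "exp (2 * Q)"] Q0 by simp
  have "exp (s * mean_G) \<le> L" using exp_mean_G_le[of s] GL by linarith
  then have "s * mean_G \<le> ln L" using L1 by (simp add: ln_ge_iff)
  \<comment> \<open>Halving is harmless because \<open>ln L\<close> is nonnegative, whatever the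
    sign of \<open>mean_G\<close>.\<close>
  then have "s / 2 * mean_G \<le> ln L" using ln_ge_zero[OF L1] by simp
  then have "exp (s / 2 * mean_G) \<le> exp (ln L)" by (subst exp_le_cancel_iff)
  then have gL: "exp (s / 2 * mean_G) \<le> L" using L1 by simp
  have int: "integrable P (\<lambda>\<omega>. exp (s / 2 * (F I \<omega> - expectation (F I))))"
  proof -
    have "exp (s / 2 * (F I \<omega> - expectation (F I))) = exp (s / 2 * F I \<omega>) * exp (- (s / 2) * expectation (F I))" for \<omega>
      by (simp add: exp_add[symmetric] algebra_simps)
    then show ?thesis using integrable_exp_F[of I "s / 2"] by simp
  qed
  have "{\<omega>\<in>space P. 20 * x \<le> F I \<omega> - expectation (F I)}
      = {\<omega>\<in>space P. exp (10 * Q) \<le> exp (s / 2 * (F I \<omega> - expectation (F I)))}"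
  proof -
    \<comment> \<open>The constant 20 enters here: Markov's inequality gains
      \<open>exp (10 * Q)\<close> against the loss \<open>L * L\<close>, which contains
      \<open>exp (4 * Q)\<close>.\<close>
    have "10 * Q = s / 2 * (20 * x)" by (simp add: sx[symmetric])
    moreover have "0 < s / 2" using s(1) by simp
    ultimately show ?thesis by (simp only: exp_le_cancel_iff mult_le_cancel_left_pos)
  qed
  then have "prob {\<omega>\<in>space P. 20 * x \<le> F I \<omega> - expectation (F I)}
      \<le> expectation (\<lambda>\<omega>. exp (s / 2 * (F I \<omega> - expectation (F I)))) / exp (10 * Q)"
    using integral_Markov_inequality_measure[OF int sets.empty_sets, of "exp (10 * Q)"] by simp
  also have "\<dots> \<le> (L * L) / exp (10 * Q)"
  proof (rule divide_right_mono)
    have "expectation (\<lambda>\<omega>. exp (s / 2 * (F I \<omega> - expectation (F I)))) \<le> exp (s / 2 * mean_G) * mean_exp_G s"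
      using s by (intro expectation_exp_F_le) simp
    also have "\<dots> \<le> L * L"
      using gL GL L1 by (intro mult_mono) (auto simp: mean_exp_G_def intro!: divide_nonneg_pos sum_nonneg)
    finally show "expectation (\<lambda>\<omega>. exp (s / 2 * (F I \<omega> - expectation (F I)))) \<le> L * L" .
  qed simp
  \<comment> \<open>Of the remaining \<open>exp (- (6 * Q))\<close> one factor
    \<open>exp (- Q)\<close> is kept for the claim; the other five absorb the second
    \<open>2 ^ d\<close>, which is at most \<open>exp Q\<close>.\<close>
  also have "\<dots> = 2 ^ d * exp (- Q) * (2 ^ d * exp (- (5 * Q)))"
    by (simp add: L_def exp_minus field_simps exp_add[symmetric])
  also have "\<dots> \<le> 2 ^ d * exp (- Q) * 1"
  proof (rule mult_left_mono)
    have "2 ^ d * exp (- (5 * Q)) \<le> exp Q * exp (- (5 * Q))" using d by (rule mult_right_mono) simp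
    also have "\<dots> \<le> 1" using Q0 by (simp add: exp_add[symmetric])
    finally show "2 ^ d * exp (- (5 * Q)) \<le> 1" .
  qed simp
  finally show ?thesis by simp
qed

end

section \<open>The maximal inequality\<close>

text \<open>Presents the rectangle below \<open>k\<close> as a coordinatewise truncation of the full
  index set, the shape demanded by Levy's inequality.\<close>

lemma idx_eq_restrict:
  assumes "k \<in> idx d n"
  shows "idx d k = {i\<in>idx d n. \<forall>c<d. i c \<le> k c}"
proof -
  have "k c \<le> n c" if "c < d" for c
    using assms that by (auto simp: idx_def PiE_iff)
  then have "i c \<le> n c" if "c < d" "i c \<le> k c" for i c
    using that le_trans by blast
  then show ?thesis by (auto simp: idx_def PiE_iff extensional_def)
qed

theorem theorem2p3:
  fixes P :: "'a measure" and d :: nat and n :: "nat \<Rightarrow> nat"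
    and Y :: "(nat \<Rightarrow> nat) \<Rightarrow> 'a \<Rightarrow> real" and b x :: real
  assumes "prob_space P"
    and "d \<ge> 1"
    and "\<forall>i<d. n i \<ge> 1"
    and "neg_assoc P Y (idx d n)"
    and "\<forall>k\<in>idx d n. Y k \<in> borel_measurable P"
    and "\<forall>k\<in>idx d n. (\<integral>\<omega>. Y k \<omega> \<partial>P) = 0"
    and "0 < b"
    and "\<forall>k\<in>idx d n. AE \<omega> in P. \<bar>Y k \<omega>\<bar> \<le> b"
    and "x > 0"
  shows "measure P {\<omega> \<in> space P.
            max_partial d Y n \<omega> - 2 * (\<integral>\<omega>'. max_partial d Y n \<omega>' \<partial>P) \<ge> 20 * x}
         \<le> 2 ^ (d + 1) * exp (- (x\<^sup>2 / (2 * (b * x + (\<Sum>k\<in>idx d n. \<integral>\<omega>. (Y k \<omega>)\<^sup>2 \<partial>P)))))"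
proof -
  let ?I = "idx d n"
  define \<K> where "\<K> = idx d ` ?I"
  define M where "M = max_partial d Y n"
  define Q where "Q = x\<^sup>2 / (2 * (b * x + (\<Sum>k\<in>?I. \<integral>\<omega>. (Y k \<omega>)\<^sup>2 \<partial>P)))"
  interpret prob_space P by fact
  have finI: "finite ?I" by (auto simp: idx_def intro!: finite_PiE)
  have neI: "?I \<noteq> {}" using assms(3) by (auto simp: idx_def PiE_eq_empty_iff)
  interpret Y: bounded_neg_assoc_family P ?I Y b \<K>
    by unfold_locales (use assms finI neI idx_eq_restrict in \<open>auto simp: \<K>_def\<close>)
  \<comment> \<open>The absolute value in \<open>M\<close> is handled by treating the field and its
    negative separately; this produces the extra factor 2 in \<open>2 ^ (d + 1)\<close>.\<close>
  interpret neg: bounded_neg_assoc P ?I "\<lambda>i \<omega>. - Y i \<omega>" b by (rule Y.uminus)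
  interpret neg: bounded_neg_assoc_family P ?I "\<lambda>i \<omega>. - Y i \<omega>" b \<K> ..
  \<comment> \<open>The level function \<open>\<tau>\<close> of direction \<open>c\<close> is the
    coordinate \<open>i c\<close>.\<close>
  have K: "\<exists>k. D = {i\<in>?I. \<forall>c<d. i c \<le> k c}" if "D \<in> \<K>" for D
    using that idx_eq_restrict by (auto simp: \<K>_def)
  have inter: "?I \<inter> idx d k = idx d k" if "k \<in> ?I" for k
    using idx_eq_restrict[OF that] by auto
  have M_ge: "\<bar>\<Sum>i\<in>idx d k. Y i \<omega>\<bar> \<le> M \<omega>" if "k \<in> ?I" for k \<omega>
    unfolding M_def max_partial_def partial_sum_def using finI that by (intro Max_ge) auto
  have M_obtains: "\<exists>k\<in>?I. M \<omega> = \<bar>\<Sum>i\<in>idx d k. Y i \<omega>\<bar>" for \<omega>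
    using Max_in[of "(\<lambda>k. \<bar>partial_sum d Y k \<omega>\<bar>) ` ?I"] finI neI
    unfolding M_def max_partial_def partial_sum_def by fastforce
  have M_nonneg: "0 \<le> M \<omega>" for \<omega> using M_obtains[of \<omega>] by auto
  have F_le: "Y.F ?I \<omega> \<le> M \<omega>" for \<omega>
  proof -
    obtain D where "D \<in> \<K>" "Y.F ?I \<omega> = (\<Sum>i\<in>?I \<inter> D. Y i \<omega>)" by (rule Y.max_sum_obtains)
    then show ?thesis using M_ge[of _ \<omega>] inter by (fastforce simp: \<K>_def)
  qed
  have F_neg_le: "neg.F ?I \<omega> \<le> M \<omega>" for \<omega>
  proof -
    obtain D where "D \<in> \<K>" "neg.F ?I \<omega> = (\<Sum>i\<in>?I \<inter> D. - Y i \<omega>)" by (rule Y.max_sum_obtains)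
    then show ?thesis using M_ge[of _ \<omega>] inter by (fastforce simp: \<K>_def sum_negf)
  qed
  have M_le: "M \<omega> \<le> Y.F ?I \<omega> \<or> M \<omega> \<le> neg.F ?I \<omega>" for \<omega>
  proof -
    obtain k where k: "k \<in> ?I" "M \<omega> = \<bar>\<Sum>i\<in>idx d k. Y i \<omega>\<bar>" using M_obtains by blast
    then have "idx d k \<in> \<K>" by (simp add: \<K>_def)
    from Y.sum_le_max_sum[OF this, of "\<lambda>i. Y i \<omega>" ?I] Y.sum_le_max_sum[OF this, of "\<lambda>i. - Y i \<omega>" ?I]
    show ?thesis using k(2) inter[OF k(1)] by (auto simp: sum_negf abs_if)
  qed
  have M_meas: "M \<in> borel_measurable P"
    unfolding M_def max_partial_def partial_sum_def
    using finI inter by (intro borel_measurable_Max borel_measurable_abs Y.measurable_sum) blast+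
  have M_int: "integrable P M"
  proof (rule Y.integrable_bounded[OF M_meas])
    fix \<omega> assume "\<And>i. i \<in> ?I \<Longrightarrow> \<bar>Y i \<omega>\<bar> \<le> b"
    then have "\<bar>Y.F ?I \<omega>\<bar> \<le> real (card ?I) * b" "\<bar>neg.F ?I \<omega>\<bar> \<le> real (card ?I) * b"
      using Y.abs_F_le[of \<omega> ?I] neg.abs_F_le[of \<omega> ?I] by simp_all
    then show "\<bar>M \<omega>\<bar> \<le> real (card ?I) * b"
      using M_le[of \<omega>] M_nonneg[of \<omega>] by linarith
  qed
  \<comment> \<open>Both one-sided means are at most \<open>expectation M\<close>, which is
    nonnegative, so subtracting \<open>2 * expectation M\<close> lowers \<open>M\<close> at least as
    much as centering either one-sided maximum does.\<close>
  have EM: "expectation (Y.F ?I) \<le> expectation M" "expectation (neg.F ?I) \<le> expectation M"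
    "0 \<le> expectation M"
    using M_int Y.integrable_F[of ?I] neg.integrable_F[of ?I] F_le F_neg_le M_nonneg
    by (auto intro!: integral_mono integral_nonneg_AE)
  let ?E = "\<lambda>f. {\<omega>\<in>space P. 20 * x \<le> f \<omega> - expectation f}"
  show ?thesis
  proof (cases "2 ^ d \<le> exp Q")
    \<comment> \<open>Here \<open>2 ^ d\<close> exceeds \<open>exp Q\<close>, so the claimed bound
      is at least 1.\<close>
    case False
    then have "1 \<le> 2 ^ d * exp (- Q)" by (simp add: exp_minus field_simps)
    then have "1 \<le> 2 ^ (d + 1) * exp (- Q)" by simp
    then show ?thesis unfolding Q_def[symmetric] using prob_le_1 order_trans by blast
  next
    case True
    have sets: "?E (Y.F ?I) \<in> events" "?E (neg.F ?I) \<in> events"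
      using Y.measurable_F[of ?I] neg.measurable_F[of ?I] by measurable
    have "prob {\<omega>\<in>space P. 20 * x \<le> M \<omega> - 2 * expectation M} \<le> prob (?E (Y.F ?I) \<union> ?E (neg.F ?I))"
    proof (rule finite_measure_mono)
      show "{\<omega>\<in>space P. 20 * x \<le> M \<omega> - 2 * expectation M} \<subseteq> ?E (Y.F ?I) \<union> ?E (neg.F ?I)"
      proof
        fix \<omega> assume "\<omega> \<in> {\<omega>\<in>space P. 20 * x \<le> M \<omega> - 2 * expectation M}"
        then show "\<omega> \<in> ?E (Y.F ?I) \<union> ?E (neg.F ?I)" using M_le[of \<omega>] EM by auto
      qed
    qed (use sets in simp)
    also have "\<dots> \<le> prob (?E (Y.F ?I)) + prob (?E (neg.F ?I))"
      using sets by (rule measure_Un_le)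
    also have "\<dots> \<le> 2 ^ d * exp (- Q) + 2 ^ d * exp (- Q)"
    proof (rule add_mono)
      show "prob (?E (Y.F ?I)) \<le> 2 ^ d * exp (- Q)"
        using assms by (intro Y.prob_F_ge_le[OF _ _ _ K _ True]) (auto simp: Q_def)
      show "prob (?E (neg.F ?I)) \<le> 2 ^ d * exp (- Q)"
        using assms by (intro neg.prob_F_ge_le[OF _ _ _ K _ True]) (auto simp: Q_def)
    qed
    finally show ?thesis unfolding Q_def[symmetric] M_def[symmetric] by (simp add: mult_ac)
  qed
qed

end
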